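(* Every mult-embedded $\mathbb{N}^2$-semigroup $S$, ordered by the graded lexicographic order $\preceq_{glex}$, satisfies the Generalized Wilf Conjecture, i.e. $$\nu(S)\,\mathrm{e}(S)\geq 2\,\gamma(S),$$ and the Extended Wilf Conjecture, i.e. $$\mathrm{n}(S)\,\mathrm{e}(S)\geq\mathcal{N}(\mathrm{Fb}(S))+1.$$
   Context: $\mathbb{N}$ contains $0$. The graded lexicographic order on $\mathbb{N}^2$ is: $x\prec_{glex}y$ iff $x_1+x_2<y_1+y_2$, or $x_1+x_2=y_1+y_2$ and $x_1<y_1$. An $\mathbb{N}^2$-semigroup is a submonoid $S\subseteq\mathbb{N}^2$ with finite gap set $\mathcal{H}(S)=\mathbb{N}^2\setminus S$. It is mult-embedded (with respect to $\preceq_{glex}$) if $S=\{0,m,2m,\ldots,(k-1)m\}\cup\{x\in\mathbb{N}^2\mid x\succeq_{glex}km\}$ for some positive integer $k$ and some non-zero $m\in\mathbb{N}^2$. For an $\mathbb{N}^2$-semigroup $S$: $\mathrm{e}(S)$ is the cardinality of its unique minimal system of generators; $\nu(S)=\sharp\{x\in S\mid x\leq h\text{ for some }h\in\mathcal{H}(S)\}$ and $\gamma(S)=\sharp\{x\in\mathbb{N}^2\mid x\leq h\text{ for some }h\in\mathcal{H}(S)\}$, where $\leq$ is the componentwise order and $\sharp$ denotes cardinality (so $\gamma(\mathbb{N}^2)=0$); $\mathrm{Fb}(S)=\max_{\preceq_{glex}}\mathcal{H}(S)$, with the convention $\mathrm{Fb}(\mathbb{N}^2)=(-1,-1)$; $\mathrm{n}(S)=\sharp\{s\in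 S\mid s\prec_{glex}\mathrm{Fb}(S)\}$; and $\mathcal{N}(\mathrm{Fb}(S))=\sharp\{x\in\mathbb{N}^2\setminus\{0\}\mid x\preceq_{glex}\mathrm{Fb}(S)\}$.
   Formalization: The Extended Wilf inequality is proved only for S different from N^2, because for S = N^2 (mult-embedded with k = 1, m = (0,1)) the convention Fb(N^2) = (-1,-1) makes it read 0 >= 1; the Generalized Wilf inequality is proved for every S. *)

theory Defs
  imports Complex_Main "HOL-Library.Product_Plus" "HOL-Library.Product_Order"
begin

text \<open>On \<^typ>\<open>nat \<times> nat\<close> and \<^typ>\<open>int \<times> int\<close>, the operations \<open>0\<close> and \<open>+\<close> and the order \<open>\<le>\<close> are
  the componentwise ones of \<^theory>\<open>HOL-Library.Product_Plus\<close> and \<^theory>\<open>HOL-Library.Product_Order\<close>.\<close>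

definition glex_less :: "'a::{plus,linorder} \<times> 'a \<Rightarrow> 'a \<times> 'a \<Rightarrow> bool" (infix "\<prec>\<^sub>g" 50) where
  "x \<prec>\<^sub>g y \<longleftrightarrow>
     fst x + snd x < fst y + snd y \<or> (fst x + snd x = fst y + snd y \<and> fst x < fst y)"

definition glex_le :: "'a::{plus,linorder} \<times> 'a \<Rightarrow> 'a \<times> 'a \<Rightarrow> bool" (infix "\<preceq>\<^sub>g" 50) where
  "x \<preceq>\<^sub>g y \<longleftrightarrow> x \<prec>\<^sub>g y \<or> x = y"

definition nmul :: "nat \<Rightarrow> nat \<times> nat \<Rightarrow> nat \<times> nat" where
  "nmul k x = (k * fst x, k * snd x)"

definition submonoid_N2 :: "(nat \<times> nat) set \<Rightarrow> bool" where
  "submonoid_N2 S \<longleftrightarrow> 0 \<in> S \<and> (\<forall>x\<in>S. \<forall>y\<in>S. x + y \<in> S)"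

definition gaps :: "(nat \<times> nat) set \<Rightarrow> (nat \<times> nat) set" where
  "gaps S = UNIV - S"

definition N2_semigroup :: "(nat \<times> nat) set \<Rightarrow> bool" where
  "N2_semigroup S \<longleftrightarrow> submonoid_N2 S \<and> finite (gaps S)"

definition mult_embedded :: "(nat \<times> nat) set \<Rightarrow> bool" where
  "mult_embedded S \<longleftrightarrow>
     (\<exists>k m. k > 0 \<and> m \<noteq> 0 \<and> S = {nmul i m | i. i < k} \<union> {x. nmul k m \<preceq>\<^sub>g x})"

definition minimal_system_of_generators :: "(nat \<times> nat) set \<Rightarrow> (nat \<times> nat) set \<Rightarrow> bool" where
  "minimal_system_of_generators S A \<longleftrightarrow>
     submonoid_N2 hull A = S \<and> (\<forall>B. B \<subset> A \<longrightarrow> submonoid_N2 hull B \<noteq> S)"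

definition embedding_dim :: "(nat \<times> nat) set \<Rightarrow> nat" where
  "embedding_dim S = card (THE A. minimal_system_of_generators S A)"

definition wilf_nu :: "(nat \<times> nat) set \<Rightarrow> nat" where
  "wilf_nu S = card {x \<in> S. \<exists>h \<in> gaps S. x \<le> h}"

definition wilf_gamma :: "(nat \<times> nat) set \<Rightarrow> nat" where
  "wilf_gamma S = card {x. \<exists>h \<in> gaps S. x \<le> h}"

definition to_Z2 :: "nat \<times> nat \<Rightarrow> int \<times> int" where
  "to_Z2 = map_prod int int"

definition Fb :: "(nat \<times> nat) set \<Rightarrow> int \<times> int" where
  "Fb S = (if gaps S = {} then (-1, -1)
           else to_Z2 (THE f. f \<in> gaps S \<and> (\<forall>h \<in> gaps S. h \<preceq>\<^sub>g f)))"

definition wilf_n :: "(nat \<times> nat) set \<Rightarrow> nat" where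
  "wilf_n S = card {s \<in> S. to_Z2 s \<prec>\<^sub>g Fb S}"

definition glex_count :: "int \<times> int \<Rightarrow> nat" where
  "glex_count f = card {x. x \<noteq> 0 \<and> to_Z2 x \<preceq>\<^sub>g f}"

text \<open>With \<open>Fb UNIV = (-1, -1)\<close>, the extended Wilf inequality for the full monoid reads \<open>0 \<ge> 1\<close>,
  although \<open>UNIV\<close> is mult-embedded (take \<open>k = 1\<close> and \<open>m = (0, 1)\<close>).\<close>

lemma mult_embedded_UNIV: "N2_semigroup UNIV" "mult_embedded UNIV"
proof -
  show "N2_semigroup UNIV"
    by (simp add: N2_semigroup_def submonoid_N2_def gaps_def)
  have "UNIV = {nmul i (0, 1) | i. i < 1} \<union> {x. nmul 1 (0, 1) \<preceq>\<^sub>g x}"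
    by (auto simp: nmul_def glex_le_def glex_less_def)
  then show "mult_embedded UNIV"
    unfolding mult_embedded_def by (intro exI[of _ 1] exI[of _ "(0, 1)"]) (simp add: zero_prod_def)
qed

lemma extended_wilf_UNIV_fails:
  "\<not> wilf_n UNIV * embedding_dim UNIV \<ge> glex_count (Fb UNIV) + 1"
proof -
  have "{s \<in> UNIV. to_Z2 s \<prec>\<^sub>g Fb UNIV} = {}"
    by (auto simp: to_Z2_def Fb_def gaps_def glex_less_def)
  then have "wilf_n UNIV = 0" unfolding wilf_n_def by (metis card.empty)
  then show ?thesis by simp
qed

end

theory Submission
  imports Defs "HOL-Library.Nat_Bijection"
begin

text \<open>
  The Cantor pairing function \<^const>\<open>prod_encode\<close> is exactly the rank function of the graded
  lexicographic order, so sizes of initial segments can be read off from it. Put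
  \<open>c = prod_encode (k m)\<close> and \<open>c' = prod_encode ((k + 1) m)\<close>.
  The semigroup has \<open>c - k\<close> gaps. Since every nonzero element is at least \<open>m\<close>, and one
  summand of a sum that is not a multiple of \<open>m\<close> is at least \<open>k m\<close>, the element \<open>m\<close> and everything
  strictly between \<open>k m\<close> and \<open>(k + 1) m\<close> are minimal generators, which gives
  \<open>e \<ge> c' - c\<close>. This suffices for the extended conjecture, where \<open>n = k\<close>. The generalized one
  is tight for \<open>m = (1, 0)\<close> and \<open>m = (0, 1)\<close>, and there one more generator on a coordinate axis
  is needed.
\<close>

section \<open>The graded lexicographic order\<close>

text \<open>The pairing function numbers the plane diagonal by diagonal: \<open>triangle s\<close>
  counts the points with coordinate sum below \<open>s\<close>, and the first coordinate is the
  position on the diagonal. Only one implication is computed; trichotomy gives the converse.\<close>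

lemma glex_less_iff_prod_encode: "x \<prec>\<^sub>g y \<longleftrightarrow> prod_encode x < prod_encode y"
proof -
  have "prod_encode x < prod_encode y" if "x \<prec>\<^sub>g y" for x y
  proof (cases "fst x + snd x = fst y + snd y")
    case True
    with that show ?thesis
      by (auto simp: glex_less_def prod_encode_def case_prod_beta)
  next
    case False
    with that have "Suc (fst x + snd x) \<le> fst y + snd y"
      by (auto simp: glex_less_def)
    \<comment> \<open>Passing to the next diagonal adds \<open>Suc (fst x + snd x)\<close>, which
      exceeds the offset \<open>fst x\<close>.\<close>
    then have "triangle (Suc (fst x + snd x)) \<le> triangle (fst y + snd y)"
      unfolding triangle_def by (intro div_le_mono mult_le_mono) auto
    then show ?thesis
      by (simp add: prod_encode_def case_prod_beta)
  qed
  moreover have "x \<prec>\<^sub>g y \<or> x = y \<or> y \<prec>\<^sub>g x"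
    by (auto simp: glex_less_def prod_eq_iff)
  ultimately show ?thesis
    by (metis less_asym less_irrefl)
qed

lemma glex_le_iff_prod_encode: "x \<preceq>\<^sub>g y \<longleftrightarrow> prod_encode x \<le> prod_encode y"
  unfolding glex_le_def glex_less_iff_prod_encode
  using inj_prod_encode[of UNIV] by (auto simp: le_less dest: injD)

lemma prod_encode_eq_0_iff: "prod_encode x = 0 \<longleftrightarrow> x = 0"
  using prod_encode_eq[of x 0] by (simp add: zero_prod_def prod_encode_def)

lemma glex_le_trans: "x \<preceq>\<^sub>g y \<Longrightarrow> y \<preceq>\<^sub>g z \<Longrightarrow> x \<preceq>\<^sub>g z" for x y z :: "nat \<times> nat"
  by (simp add: glex_le_iff_prod_encode)

lemma not_glex_le: "\<not> x \<preceq>\<^sub>g y \<longleftrightarrow> y \<prec>\<^sub>g x" for x y :: "nat \<times> nat"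
  by (simp add: glex_le_iff_prod_encode glex_less_iff_prod_encode not_le)

lemma glex_le_imp_not_less: "x \<preceq>\<^sub>g y \<Longrightarrow> \<not> y \<prec>\<^sub>g x" for x y :: "nat \<times> nat"
  using not_glex_le by blast

lemma glex_less_le_trans: "x \<prec>\<^sub>g y \<Longrightarrow> y \<preceq>\<^sub>g z \<Longrightarrow> x \<prec>\<^sub>g z" for x y z :: "nat \<times> nat"
  by (simp add: glex_le_iff_prod_encode glex_less_iff_prod_encode)

lemma glex_le_less_trans: "x \<preceq>\<^sub>g y \<Longrightarrow> y \<prec>\<^sub>g z \<Longrightarrow> x \<prec>\<^sub>g z" for x y z :: "nat \<times> nat"
  by (simp add: glex_le_iff_prod_encode glex_less_iff_prod_encode)

lemma le_imp_glex_le: "x \<le> y \<Longrightarrow> x \<preceq>\<^sub>g y" for x y :: "nat \<times> nat"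
  by (auto simp: glex_le_def glex_less_def less_eq_prod_def prod_eq_iff)

lemma glex_le_add_mono: "x \<preceq>\<^sub>g x' \<Longrightarrow> y \<preceq>\<^sub>g y' \<Longrightarrow> x + y \<preceq>\<^sub>g x' + y'"
  for x y :: "nat \<times> nat"
  by (auto simp: glex_le_def glex_less_def)

lemma glex_less_add_left: "x \<prec>\<^sub>g y \<Longrightarrow> z + x \<prec>\<^sub>g z + y" for x y z :: "nat \<times> nat"
  by (auto simp: glex_less_def)

lemma card_encode_less: "card {x. prod_encode x < n} = n"
  and finite_encode_less: "finite {x. prod_encode x < n}"
proof -
  have "{x. prod_encode x < n} = prod_decode ` {..<n}"
    by (auto intro!: image_eqI[of _ _ "prod_encode _"])
  then show "card {x. prod_encode x < n} = n" "finite {x. prod_encode x < n}"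
    by (simp_all add: card_image inj_prod_decode)
qed

lemma card_encode_between: "card {x. l < prod_encode x \<and> prod_encode x < n} = n - Suc l"
proof -
  have "{x. l < prod_encode x \<and> prod_encode x < n} = prod_decode ` {l<..<n}"
    by (auto intro!: image_eqI[of _ _ "prod_encode _"])
  then show ?thesis
    by (simp add: card_image inj_prod_decode)
qed

lemma to_Z2_glex_less: "to_Z2 x \<prec>\<^sub>g to_Z2 y \<longleftrightarrow> x \<prec>\<^sub>g y"
  unfolding glex_less_def to_Z2_def by (cases x; cases y) (auto simp flip: of_nat_add)

lemma to_Z2_glex_le: "to_Z2 x \<preceq>\<^sub>g to_Z2 y \<longleftrightarrow> x \<preceq>\<^sub>g y"
  unfolding glex_le_def to_Z2_glex_less by (auto simp: to_Z2_def prod_eq_iff)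

section \<open>Multiples\<close>

lemma nmul_0 [simp]: "nmul 0 m = 0"
  by (simp add: nmul_def zero_prod_def)

lemma nmul_1 [simp]: "nmul (Suc 0) m = m"
  by (simp add: nmul_def)

lemma nmul_add: "nmul (i + j) m = nmul i m + nmul j m"
  by (simp add: nmul_def algebra_simps)

lemma nmul_Suc: "nmul (Suc i) m = nmul i m + m"
  by (simp add: nmul_def prod_eq_iff)

lemma nmul_glex_mono: "i \<le> j \<Longrightarrow> nmul i m \<preceq>\<^sub>g nmul j m"
  by (intro le_imp_glex_le) (simp add: nmul_def less_eq_prod_def)

lemma nmul_glex_strict_mono: "m \<noteq> 0 \<Longrightarrow> i < j \<Longrightarrow> nmul i m \<prec>\<^sub>g nmul j m"
  by (auto simp: nmul_def glex_less_def zero_prod_def prod_eq_iff simp flip: distrib_left)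

lemma inj_nmul: "m \<noteq> 0 \<Longrightarrow> inj (\<lambda>i. nmul i m)"
  by (auto simp: inj_def nmul_def zero_prod_def prod_eq_iff)

text \<open>Doubling clears the halving in the triangular number and leaves a polynomial, so that
  the later estimates are polynomial arithmetic.\<close>

lemma double_prod_encode_nmul:
  "2 * prod_encode (nmul k m)
     = k * (fst m + snd m) * (k * (fst m + snd m) + 1) + 2 * k * fst m"
proof -
  have "2 * triangle n = n * (n + 1)" for n
    by (simp add: triangle_def)
  from this[of "k * (fst m + snd m)"] show ?thesis
    by (simp add: prod_encode_def nmul_def distrib_left)
qed

lemma double_prod_encode_nmul_diff:
  "2 * (prod_encode (nmul (Suc k) m) - prod_encode (nmul k m))
     = (2 * k + 1) * ((fst m + snd m) * (fst m + snd m)) + (fst m + snd m) + 2 * fst m"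
  unfolding diff_mult_distrib2 double_prod_encode_nmul by (simp add: algebra_simps)

section \<open>The minimal system of generators\<close>

text \<open>The atoms of the monoid. They turn out to be the unique minimal system of generators, so
  bounds on \<open>embedding_dim\<close> become cardinality bounds.\<close>

definition irreducibles :: "(nat \<times> nat) set \<Rightarrow> (nat \<times> nat) set" where
  "irreducibles S = {x \<in> S. x \<noteq> 0 \<and> (\<forall>y\<in>S. \<forall>z\<in>S. x = y + z \<longrightarrow> y = 0 \<or> z = 0)}"

lemma submonoid_hull: "submonoid_N2 (submonoid_N2 hull A)"
  by (rule hull_in) (auto simp: submonoid_N2_def)

text \<open>Removing an irreducible \<open>x\<close> from \<open>S\<close> leaves a submonoid, so
  generators avoiding \<open>x\<close> can never produce it.\<close>

lemma irreducibles_subset_generators: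
  assumes "submonoid_N2 S" "submonoid_N2 hull A = S"
  shows "irreducibles S \<subseteq> A"
proof
  fix x assume x: "x \<in> irreducibles S"
  show "x \<in> A"
  proof (rule ccontr)
    assume "x \<notin> A"
    moreover have "A \<subseteq> S"
      using hull_subset[of A submonoid_N2] assms(2) by simp
    moreover have "submonoid_N2 (S - {x})"
      unfolding submonoid_N2_def
    proof (intro conjI ballI)
      show "0 \<in> S - {x}"
        using x assms(1) unfolding submonoid_N2_def irreducibles_def by blast
      fix y z assume yz: "y \<in> S - {x}" "z \<in> S - {x}"
      with assms(1) have "y + z \<in> S"
        unfolding submonoid_N2_def by blast
      moreover have "y + z \<noteq> x"
      proof
        assume "y + z = x"
        with x yz have "y = 0 \<or> z = 0"
          unfolding irreducibles_def by blast
        with yz \<open>y + z = x\<close> show False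
          by fastforce
      qed
      ultimately show "y + z \<in> S - {x}"
        by simp
    qed
    ultimately have "submonoid_N2 hull A \<subseteq> S - {x}"
      by (intro hull_minimal) auto
    then have "S \<subseteq> S - {x}"
      using assms(2) by simp
    with x show False
      by (auto simp: irreducibles_def)
  qed
qed

text \<open>Splitting a reducible element into two nonzero summands lowers the coordinate sum of
  both parts, so repeated splitting ends in irreducibles.\<close>

lemma hull_irreducibles:
  assumes "submonoid_N2 S"
  shows "submonoid_N2 hull irreducibles S = S"
proof
  show "submonoid_N2 hull irreducibles S \<subseteq> S"
    using assms by (intro hull_minimal) (auto simp: irreducibles_def)
  have "x \<in> S \<Longrightarrow> x \<in> submonoid_N2 hull irreducibles S" for x
  proof (induction "fst x + snd x" arbitrary: x rule: less_induct)
    case less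
    consider "x = 0" | "x \<in> irreducibles S"
      | y z where "y \<in> S" "z \<in> S" "x = y + z" "y \<noteq> 0" "z \<noteq> 0"
      using less.prems unfolding irreducibles_def by blast
    then show ?case
    proof cases
      case 1
      then show ?thesis
        using submonoid_hull by (auto simp: submonoid_N2_def)
    next
      case 2
      then show ?thesis
        by (rule hull_inc)
    next
      case 3
      then have "fst y + snd y < fst x + snd x" "fst z + snd z < fst x + snd x"
        by (auto simp: zero_prod_def prod_eq_iff)
      with 3 less.hyps show ?thesis
        using submonoid_hull[of "irreducibles S"] by (auto simp: submonoid_N2_def)
    qed
  qed
  then show "S \<subseteq> submonoid_N2 hull irreducibles S"
    by blast
qed

lemma embedding_dim_eq_card_irreducibles:
  assumes "submonoid_N2 S"
  shows "embedding_dim S = card (irreducibles S)"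
proof -
  have "minimal_system_of_generators S (irreducibles S)"
    unfolding minimal_system_of_generators_def
    using hull_irreducibles[OF assms] irreducibles_subset_generators[OF assms] by blast
  moreover have "A = irreducibles S" if "minimal_system_of_generators S A" for A
    using that hull_irreducibles[OF assms] irreducibles_subset_generators[OF assms, of A]
    unfolding minimal_system_of_generators_def by (metis psubsetI)
  ultimately have "(THE A. minimal_system_of_generators S A) = irreducibles S"
    by (rule the_equality)
  then show ?thesis
    by (simp add: embedding_dim_def)
qed

text \<open>Every point of large coordinate sum lies in \<open>S\<close>, and a point of at least
  twice that size splits into two such points. Finiteness is what makes \<open>card\<close> monotone
  in the lower bounds on \<open>embedding_dim\<close>.\<close>

lemma finite_irreducibles:
  assumes "finite (gaps S)"
  shows "finite (irreducibles S)"
proof -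
  obtain N where N: "\<And>x. fst x + snd x \<ge> N \<Longrightarrow> x \<in> S"
  proof
    fix x
    assume "Suc (Max ((\<lambda>x. fst x + snd x) ` gaps S)) \<le> fst x + snd x"
    moreover have "fst x + snd x \<le> Max ((\<lambda>x. fst x + snd x) ` gaps S)" if "x \<in> gaps S"
      using assms that by (intro Max_ge) auto
    ultimately have "x \<notin> gaps S"
      by linarith
    then show "x \<in> S"
      by (simp add: gaps_def)
  qed
  have "fst x + snd x < 2 * Suc N" if "x \<in> irreducibles S" for x
  proof (rule ccontr)
    assume large: "\<not> fst x + snd x < 2 * Suc N"
    \<comment> \<open>\<open>y\<close> is a part of \<open>x\<close> with coordinate sum exactly
      \<open>Suc N\<close>, filled from the first coordinate before the second. Taking
      \<open>Suc N\<close> instead of \<open>N\<close> keeps both parts nonzero even for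
      \<open>N = 0\<close>.\<close>
    define y where "y = (min (fst x) (Suc N), Suc N - min (fst x) (Suc N))"
    define z where "z = (fst x - fst y, snd x - snd y)"
    have "x = y + z" "y \<in> S" "z \<in> S" "y \<noteq> 0" "z \<noteq> 0"
      using large by (auto simp: y_def z_def prod_eq_iff zero_prod_def intro!: N)
    with that show False
      by (auto simp: irreducibles_def)
  qed
  then have "irreducibles S \<subseteq> {..<2 * Suc N} \<times> {..<2 * Suc N}"
    by (force simp: mem_Times_iff)
  then show ?thesis
    by (rule finite_subset) simp
qed

text \<open>Each gap lies below itself, so the points below gaps are the disjoint union of the gaps
  and the points counted by \<open>wilf_nu\<close>. They are finitely many because each gap bounds a
  finite box.\<close>

lemma wilf_gamma_eq:
  assumes "finite (gaps S)"
  shows "wilf_gamma S = wilf_nu S + card (gaps S)"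
    and "finite {x \<in> S. \<exists>h\<in>gaps S. x \<le> h}"
proof -
  have "{x. \<exists>h\<in>gaps S. x \<le> h} \<subseteq> (\<Union>h\<in>gaps S. {..fst h} \<times> {..snd h})"
    by (auto simp: less_eq_prod_def)
  then have "finite {x. \<exists>h\<in>gaps S. x \<le> h}"
    by (rule finite_subset) (simp add: assms)
  then show fin: "finite {x \<in> S. \<exists>h\<in>gaps S. x \<le> h}"
    by (rule rev_finite_subset) auto
  have "{x. \<exists>h\<in>gaps S. x \<le> h} = {x \<in> S. \<exists>h\<in>gaps S. x \<le> h} \<union> gaps S"
    by (auto simp: gaps_def)
  then show "wilf_gamma S = wilf_nu S + card (gaps S)"
    unfolding wilf_gamma_def wilf_nu_def
    using fin assms by (simp add: card_Un_disjoint gaps_def disjoint_iff)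
qed

section \<open>Mult-embedded semigroups\<close>

locale mult_embedding =
  fixes S :: "(nat \<times> nat) set" and k :: nat and m :: "nat \<times> nat"
  assumes k_pos: "k > 0" and m_nonzero: "m \<noteq> 0"
    and S_eq: "S = {nmul i m | i. i < k} \<union> {x. nmul k m \<preceq>\<^sub>g x}"
    and semigroup: "N2_semigroup S"
begin

section \<open>Minimal generators up to \<open>nmul (Suc k) m\<close>\<close>

lemma finite_gaps: "finite (gaps S)"
  using semigroup by (simp add: N2_semigroup_def)

lemma S_cases:
  assumes "x \<in> S"
  obtains i where "x = nmul i m" | "nmul k m \<preceq>\<^sub>g x"
  using assms S_eq by auto

lemma nmul_mem: "i < k \<Longrightarrow> nmul i m \<in> S"
  using S_eq by auto

text \<open>Positive multiples of \<open>m\<close>, in particular \<open>nmul k m\<close>, do not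
  precede \<open>m\<close>; hence \<open>m\<close> is the multiplicity of \<open>S\<close>.\<close>

lemma nonzero_ge:
  assumes "x \<in> S" "x \<noteq> 0"
  shows "m \<preceq>\<^sub>g x"
proof -
  consider i where "x = nmul i m" | "nmul k m \<preceq>\<^sub>g x"
    using assms(1) S_cases by blast
  then show ?thesis
  proof cases
    case (1 i)
    with assms(2) have "1 \<le> i"
      by (cases i) auto
    with 1 show ?thesis
      using nmul_glex_mono[of 1 i m] by simp
  next
    case 2
    then show ?thesis
      using nmul_glex_mono[of 1 k m] k_pos glex_le_trans by (simp add: Suc_le_eq)
  qed
qed

lemma irreducible_m: "m \<in> irreducibles S"
proof -
  have "m \<in> S"
    using k_pos S_eq nmul_glex_mono[of k 1 m] by (cases "k = 1") (force intro!: exI[of _ 1])+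
  moreover have "y = 0 \<or> z = 0" if "y \<in> S" "z \<in> S" "m = y + z" for y z
  proof (rule ccontr)
    assume "\<not> (y = 0 \<or> z = 0)"
    with that have "m + m \<preceq>\<^sub>g m"
      using glex_le_add_mono nonzero_ge by metis
    moreover have "m \<prec>\<^sub>g m + m"
      using nmul_glex_strict_mono[OF m_nonzero, of 1 2] by (simp add: numeral_2_eq_2 nmul_Suc)
    ultimately show False
      by (simp add: glex_le_imp_not_less)
  qed
  ultimately show ?thesis
    using m_nonzero by (auto simp: irreducibles_def)
qed

lemma irreducible_between:
  assumes "nmul k m \<prec>\<^sub>g x" "x \<prec>\<^sub>g nmul (Suc k) m"
  shows "x \<in> irreducibles S"
proof -
  have not_multiple: "x \<noteq> nmul i m" for i
  proof
    assume "x = nmul i m"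
    then show False
      using assms nmul_glex_mono[of i k m] nmul_glex_mono[of "Suc k" i m] not_glex_le
      by (metis not_less_eq_eq)
  qed
  have "y = 0 \<or> z = 0" if "y \<in> S" "z \<in> S" "x = y + z" for y z
  proof (rule ccontr)
    assume "\<not> (y = 0 \<or> z = 0)"
    then have ge: "m \<preceq>\<^sub>g y" "m \<preceq>\<^sub>g z"
      using that nonzero_ge by auto
    \<comment> \<open>Were both summands multiples of \<open>m\<close>, then \<open>x\<close> would
      be one too. The summand that is not below \<open>nmul k m\<close>, together with the other
      one, which is at least \<open>m\<close>, reaches \<open>nmul (Suc k) m\<close>.\<close>
    have "nmul k m \<preceq>\<^sub>g y \<or> nmul k m \<preceq>\<^sub>g z"
      using that not_multiple by (metis S_cases nmul_add)
    then have "nmul (Suc k) m \<preceq>\<^sub>g x"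
      using ge that glex_le_add_mono unfolding nmul_Suc by (metis add.commute)
    with assms(2) show False
      using not_glex_le by blast
  qed
  moreover have "x \<in> S" "x \<noteq> 0"
    using assms(1) S_eq not_multiple[of 0] by (auto simp: glex_le_def)
  ultimately show ?thesis
    by (auto simp: irreducibles_def)
qed

text \<open>The open interval has one point less than the rank distance of its ends;
  \<open>m\<close>, which is at most \<open>nmul k m\<close> and so lies outside it, makes up for
  that.\<close>

definition irreducible_block :: "(nat \<times> nat) set" where
  "irreducible_block = insert m {x. nmul k m \<prec>\<^sub>g x \<and> x \<prec>\<^sub>g nmul (Suc k) m}"

lemma card_irreducible_block:
  "finite irreducible_block"
  "card irreducible_block = prod_encode (nmul (Suc k) m) - prod_encode (nmul k m)"
proof -
  let ?B = "{x. nmul k m \<prec>\<^sub>g x \<and> x \<prec>\<^sub>g nmul (Suc k) m}"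
  have fin: "finite ?B"
    by (rule finite_subset[OF _ finite_encode_less]) (auto simp: glex_less_iff_prod_encode)
  then show "finite irreducible_block"
    by (simp add: irreducible_block_def)
  have "m \<notin> ?B"
    using nmul_glex_mono[of 1 k m] k_pos glex_le_imp_not_less by (simp add: Suc_le_eq)
  moreover have "prod_encode (nmul k m) < prod_encode (nmul (Suc k) m)"
    using nmul_glex_strict_mono[OF m_nonzero, of k "Suc k"]
    by (simp add: glex_less_iff_prod_encode)
  ultimately show "card irreducible_block = prod_encode (nmul (Suc k) m) - prod_encode (nmul k m)"
    using fin by (simp add: irreducible_block_def glex_less_iff_prod_encode card_encode_between)
qed

lemma irreducible_block_subset: "irreducible_block \<subseteq> irreducibles S"
  using irreducible_m irreducible_between by (auto simp: irreducible_block_def)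

lemma embedding_dim_ge:
  "embedding_dim S \<ge> prod_encode (nmul (Suc k) m) - prod_encode (nmul k m)"
  using semigroup card_mono[OF finite_irreducibles[OF finite_gaps] irreducible_block_subset]
  by (simp add: embedding_dim_eq_card_irreducibles N2_semigroup_def card_irreducible_block)

section \<open>A further generator on a coordinate axis\<close>

lemma embedding_dim_gt:
  assumes "x \<in> irreducibles S" "nmul (Suc k) m \<prec>\<^sub>g x"
  shows "embedding_dim S > prod_encode (nmul (Suc k) m) - prod_encode (nmul k m)"
proof -
  have "m \<preceq>\<^sub>g nmul (Suc k) m"
    using nmul_glex_mono[of 1 "Suc k" m] by simp
  then have "x \<notin> irreducible_block"
    using assms(2) not_glex_le by (auto simp: irreducible_block_def glex_le_def glex_less_iff_prod_encode)
  then have "irreducible_block \<subset> irreducibles S"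
    using assms(1) irreducible_block_subset by blast
  then show ?thesis
    using semigroup psubset_card_mono[OF finite_irreducibles[OF finite_gaps]]
    by (simp add: embedding_dim_eq_card_irreducibles N2_semigroup_def
        flip: card_irreducible_block(2))
qed

text \<open>No positive multiple of \<open>m\<close> lies on the second axis, and
  \<open>(0, k * d)\<close> still precedes \<open>nmul k m\<close>. Nonzero elements of
  \<open>S\<close> on this axis therefore have height at least \<open>k * d + 1\<close>, and two of
  them add up to more than the height of the chosen point.\<close>

lemma embedding_dim_gt_of_fst_pos:
  assumes "fst m > 0"
  shows "embedding_dim S > prod_encode (nmul (Suc k) m) - prod_encode (nmul k m)"
proof (rule embedding_dim_gt)
  define d where "d = fst m + snd m"
  \<comment> \<open>The lowest point of the second axis beyond \<open>nmul (Suc k) m\<close>: at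
    height \<open>Suc k * d\<close> the coordinate sums agree, but the first coordinate 0 is
    smaller.\<close>
  let ?x = "(0, Suc (Suc k * d))"
  show "nmul (Suc k) m \<prec>\<^sub>g ?x"
    by (simp add: glex_less_def nmul_def d_def algebra_simps)
  have axis: "t \<ge> Suc (k * d)" if "(0, t) \<in> S" "t \<noteq> 0" for t
  proof (cases "\<exists>i. (0, t) = nmul i m")
    case True
    with assms that(2) show ?thesis
      by (auto simp: nmul_def)
  next
    case False
    with that S_cases have "nmul k m \<preceq>\<^sub>g (0, t)"
      by metis
    then show ?thesis
      using assms k_pos by (auto simp: glex_le_def glex_less_def nmul_def d_def algebra_simps)
  qed
  have "y = 0 \<or> z = 0" if yz: "y \<in> S" "z \<in> S" "?x = y + z" for y z
  proof (rule ccontr)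
    assume nz: "\<not> (y = 0 \<or> z = 0)"
    obtain s t where st: "y = (0, s)" "z = (0, t)"
      using yz(3) by (cases y; cases z) auto
    then have "s \<ge> Suc (k * d)" "t \<ge> Suc (k * d)"
      using axis yz nz by (auto simp: zero_prod_def)
    moreover have "s + t = Suc (d + k * d)"
      using yz(3) st by simp
    moreover have "d \<le> k * d"
      using k_pos by simp
    ultimately show False
      by linarith
  qed
  moreover have "?x \<in> S"
    using S_eq by (auto simp: glex_le_def glex_less_def nmul_def d_def algebra_simps)
  ultimately show "?x \<in> irreducibles S"
    by (simp add: irreducibles_def zero_prod_def)
qed

text \<open>Nonzero elements of \<open>S\<close> on the first axis have length at least
  \<open>k\<close>, and \<open>k + k\<close> exceeds \<open>Suc k\<close> once \<open>k\<close> is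
  at least 2. For \<open>k = 1\<close> the semigroup is the full monoid, where \<open>(2, 0)\<close>
  splits.\<close>

lemma embedding_dim_gt_of_unit:
  assumes "m = (0, 1)" "k \<ge> 2"
  shows "embedding_dim S > prod_encode (nmul (Suc k) m) - prod_encode (nmul k m)"
proof (rule embedding_dim_gt)
  let ?x = "(Suc k, 0)"
  show "nmul (Suc k) m \<prec>\<^sub>g ?x"
    by (simp add: glex_less_def nmul_def assms)
  have axis: "t \<ge> k" if "(t, 0) \<in> S" "t \<noteq> 0" for t
    using that S_eq by (auto simp: assms nmul_def glex_le_def glex_less_def)
  have "y = 0 \<or> z = 0" if yz: "y \<in> S" "z \<in> S" "?x = y + z" for y z
  proof (rule ccontr)
    assume nz: "\<not> (y = 0 \<or> z = 0)"
    obtain s t where st: "y = (s, 0)" "z = (t, 0)"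
      using yz(3) by (cases y; cases z) auto
    then have "s \<ge> k" "t \<ge> k"
      using axis yz nz by (auto simp: zero_prod_def)
    moreover have "s + t = Suc k"
      using yz(3) st by simp
    ultimately show False
      using assms by linarith
  qed
  moreover have "?x \<in> S"
    using S_eq by (auto simp: glex_le_def glex_less_def nmul_def assms)
  ultimately show "?x \<in> irreducibles S"
    by (simp add: irreducibles_def zero_prod_def)
qed

section \<open>Counting gaps and the elements below them\<close>

lemma card_gaps: "card (gaps S) + k = prod_encode (nmul k m)"
proof -
  \<comment> \<open>The points preceding \<open>nmul k m\<close> are the gaps and the first
    \<open>k\<close> multiples of \<open>m\<close>; their total number is the rank of
    \<open>nmul k m\<close>.\<close>
  have "{x. prod_encode x < prod_encode (nmul k m)} = gaps S \<union> (\<lambda>i. nmul i m) ` {..<k}"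
    using nmul_glex_strict_mono[OF m_nonzero, of _ k]
    by (auto simp: gaps_def S_eq glex_le_iff_prod_encode glex_less_iff_prod_encode not_le)
  moreover have "gaps S \<inter> (\<lambda>i. nmul i m) ` {..<k} = {}"
    by (auto simp: gaps_def S_eq)
  ultimately have "card {x. prod_encode x < prod_encode (nmul k m)} = card (gaps S) + k"
    using finite_gaps
    by (simp add: card_Un_disjoint card_image inj_on_subset[OF inj_nmul[OF m_nonzero]])
  then show ?thesis
    by (simp add: card_encode_less)
qed

text \<open>\<open>(0, 1)\<close> is the smallest nonzero point, so for any other \<open>m\<close>
  this shift stays strictly between two consecutive multiples of \<open>m\<close>. It yields a gap
  componentwise above each of the first \<open>k\<close> multiples.\<close>

lemma gap_above_multiple:
  assumes "m \<noteq> (0, 1)" "i < k"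
  shows "nmul i m + (0, 1) \<in> gaps S"
proof -
  let ?h = "nmul i m + (0, 1)"
  have "(0, 1) \<prec>\<^sub>g m"
    using assms(1) m_nonzero by (cases m) (auto simp: glex_less_def zero_prod_def)
  then have "?h \<prec>\<^sub>g nmul (Suc i) m"
    unfolding nmul_Suc by (rule glex_less_add_left)
  then have less: "?h \<prec>\<^sub>g nmul j m" if "i < j" for j
    using nmul_glex_mono[of "Suc i" j m] that by (simp add: glex_less_le_trans Suc_le_eq)
  have "?h \<noteq> nmul j m" for j
  proof
    assume eq: "?h = nmul j m"
    have "nmul i m \<prec>\<^sub>g ?h"
      by (simp add: glex_less_def)
    with eq have "i < j"
      using nmul_glex_mono[of j i m] not_glex_le by (metis not_le)
    with less eq show False
      by (metis glex_less_iff_prod_encode less_irrefl)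
  qed
  moreover have "\<not> nmul k m \<preceq>\<^sub>g ?h"
    using less assms(2) not_glex_le by blast
  ultimately show ?thesis
    by (auto simp: gaps_def S_eq)
qed

text \<open>Replaces \<open>gap_above_multiple\<close> for \<open>m = (0, 1)\<close>. The last
  multiple \<open>(0, k - 1)\<close> has no gap componentwise above it, so \<open>k - 1\<close>
  multiples remain.\<close>

lemma gap_unit:
  assumes "m = (0, 1)" "Suc i < k"
  shows "(1, i) \<in> gaps S"
  using assms by (auto simp: gaps_def S_eq nmul_def glex_le_def glex_less_def)

lemma wilf_nu_ge:
  assumes "\<And>i. i < l \<Longrightarrow> \<exists>h\<in>gaps S. nmul i m \<le> h" "l \<le> k"
  shows "l \<le> wilf_nu S"
proof -
  have "(\<lambda>i. nmul i m) ` {..<l} \<subseteq> {x \<in> S. \<exists>h\<in>gaps S. x \<le> h}"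
    using assms by (auto simp: S_eq)
  from card_mono[OF wilf_gamma_eq(2)[OF finite_gaps] this] show ?thesis
    by (simp add: wilf_nu_def card_image inj_on_subset[OF inj_nmul[OF m_nonzero]])
qed

section \<open>The two Wilf inequalities\<close>

lemma generalized_wilf: "wilf_nu S * embedding_dim S \<ge> 2 * wilf_gamma S"
proof -
  define d where "d = fst m + snd m"
  define a where "a = fst m"
  define c where "c = prod_encode (nmul k m)"
  define g where "g = card (gaps S)"
  define e where "e = embedding_dim S"
  have c: "2 * c = k * d * (k * d + 1) + 2 * k * a"
    unfolding c_def a_def d_def by (rule double_prod_encode_nmul)
  have g: "g + k = c"
    unfolding g_def c_def by (rule card_gaps)
  define D where "D = prod_encode (nmul (Suc k) m) - prod_encode (nmul k m)"
  have diff: "2 * D = (2 * k + 1) * (d * d) + d + 2 * a"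
    unfolding D_def a_def d_def by (rule double_prod_encode_nmul_diff)
  \<comment> \<open>Since \<open>wilf_gamma S = wilf_nu S + g\<close>, the claim amounts to
    \<open>2 * g \<le> wilf_nu S * (e - 2)\<close>. Here \<open>n\<close> is a lower bound for
    \<open>wilf_nu S\<close>, and \<open>e'\<close> stands for \<open>e - 2\<close> without
    truncated subtraction.\<close>
  have "\<exists>n e'. n \<le> wilf_nu S \<and> e = e' + 2 \<and> 2 * g \<le> n * e'"
  proof (cases "m = (0, 1)")
    case True
    then have ad: "a = 0" "d = 1"
      by (auto simp: a_def d_def)
    have nu: "k - 1 \<le> wilf_nu S"
    proof (rule wilf_nu_ge)
      fix i assume "i < k - 1"
      then have "(1, i) \<in> gaps S"
        using gap_unit[OF True] by simp
      moreover have "nmul i m \<le> (1, i)"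
        by (simp add: True nmul_def)
      ultimately show "\<exists>h\<in>gaps S. nmul i m \<le> h"
        by blast
    qed simp
    have D: "D = k + 1"
      using diff ad by (simp add: algebra_simps)
    have e: "e \<ge> k + 1 + (if k \<ge> 2 then 1 else 0)"
      using embedding_dim_ge embedding_dim_gt_of_unit[OF True] D
      by (auto simp: e_def D_def)
    have "2 * g = (k - 1) * k"
      using c g ad k_pos by (cases k) (auto simp: algebra_simps)
    \<comment> \<open>For \<open>k \<ge> 2\<close> the extra generator gives
      \<open>e - 2 \<ge> k\<close>; for \<open>k = 1\<close> both sides vanish.\<close>
    also have "\<dots> \<le> (k - 1) * (e - 2)"
      using e by (cases "k \<ge> 2") auto
    finally have "2 * g \<le> (k - 1) * (e - 2)" .
    moreover have "e = e - 2 + 2"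
      using e k_pos by simp
    ultimately show ?thesis
      using nu by blast
  next
    case False
    have nu: "k \<le> wilf_nu S"
    proof (rule wilf_nu_ge)
      fix i assume "i < k"
      then show "\<exists>h\<in>gaps S. nmul i m \<le> h"
        using gap_above_multiple[OF False]
        by (intro bexI[of _ "nmul i m + (0, 1)"]) (simp_all add: less_eq_prod_def)
    qed simp
    have d_pos: "d \<ge> 1"
      using m_nonzero by (auto simp: d_def zero_prod_def prod_eq_iff Suc_le_eq)
    \<comment> \<open>The target \<open>k * (d * d) + d + 2 * a\<close> is the cofactor of
      \<open>k\<close> in \<open>2 * c\<close>. By \<open>diff\<close> it remains to bound
      \<open>d + 2 * a\<close> by \<open>d * d\<close>, with an allowance of 2 from the extra
      generator if \<open>a > 0\<close>.\<close>
    have "2 * D + 2 * (if a > 0 then 1 else 0) \<ge> 2 * (k * (d * d) + d + 2 * a)"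
    proof (cases "a > 0")
      case True
      have "a \<le> d"
        by (simp add: a_def d_def)
      \<comment> \<open>This is \<open>(d - 1) * (d - 2) \<ge> 0\<close> over the integers.\<close>
      moreover have "3 * d \<le> d * d + 2"
      proof (cases "d \<ge> 3")
        case True
        then show ?thesis
          using mult_le_mono1[of 3 d d] by linarith
      next
        case False
        with d_pos have "d = 1 \<or> d = 2"
          by linarith
        then show ?thesis
          by (elim disjE) simp_all
      qed
      ultimately have "d + 2 * a \<le> d * d + 2"
        by linarith
      with diff True show ?thesis
        by (simp add: algebra_simps)
    next
      case False
      moreover have "d \<le> d * d"
        by simp
      ultimately show ?thesis
        using diff by (simp add: algebra_simps)
    qed
    moreover have "e \<ge> D + (if a > 0 then 1 else 0)"
      using embedding_dim_ge embedding_dim_gt_of_fst_pos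
      by (auto simp: e_def D_def a_def Suc_le_eq)
    ultimately have e: "e \<ge> k * (d * d) + d + 2 * a"
      unfolding distrib_left[symmetric] by (meson le_trans mult_le_cancel1 zero_less_numeral)
    have "2 * g + 2 * k = k * (k * (d * d) + d + 2 * a)"
      using c g by (simp add: algebra_simps)
    also have "\<dots> \<le> k * e"
      using e by (rule mult_le_mono2)
    finally have "2 * g \<le> k * (e - 2)"
      by (simp add: diff_mult_distrib2)
    moreover have "1 \<le> k * (d * d)"
      using k_pos d_pos by (simp add: Suc_le_eq)
    then have "e = e - 2 + 2"
      using e d_pos by linarith
    ultimately show ?thesis
      using nu by blast
  qed
  then obtain n e' where "n \<le> wilf_nu S" "e = e' + 2" "2 * g \<le> n * e'"
    by blast
  then have "2 * g \<le> wilf_nu S * e'"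
    using mult_le_mono1 le_trans by blast
  with \<open>e = e' + 2\<close> have "2 * g + 2 * wilf_nu S \<le> wilf_nu S * e"
    by (simp add: algebra_simps)
  then show ?thesis
    using wilf_gamma_eq(1)[OF finite_gaps] by (simp add: e_def g_def)
qed

text \<open>All \<open>k\<close> small multiples precede the Frobenius element, which itself
  precedes \<open>nmul k m\<close>. With \<open>c\<close> and \<open>c'\<close> the ranks of
  \<open>nmul k m\<close> and \<open>nmul (Suc k) m\<close>, it suffices that
  \<open>k * (c' - c) \<ge> c\<close>.\<close>

lemma extended_wilf:
  assumes "S \<noteq> UNIV"
  shows "wilf_n S * embedding_dim S \<ge> glex_count (Fb S) + 1"
proof -
  define f where "f = (THE f. f \<in> gaps S \<and> (\<forall>h\<in>gaps S. h \<preceq>\<^sub>g f))"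
  have nonempty: "gaps S \<noteq> {}"
    using assms by (auto simp: gaps_def)
  have "\<exists>f. f \<in> gaps S \<and> (\<forall>h\<in>gaps S. h \<preceq>\<^sub>g f)"
    using Max_in[of "prod_encode ` gaps S"] Max_ge[of "prod_encode ` gaps S"] finite_gaps nonempty
    by (fastforce simp: glex_le_iff_prod_encode)
  then have "\<exists>!f. f \<in> gaps S \<and> (\<forall>h\<in>gaps S. h \<preceq>\<^sub>g f)"
    by (metis not_glex_le glex_le_def)
  from theI'[OF this] have f: "f \<in> gaps S" "\<And>h. h \<in> gaps S \<Longrightarrow> h \<preceq>\<^sub>g f"
    unfolding f_def by auto
  have Fb: "Fb S = to_Z2 f"
    using nonempty by (simp add: Fb_def f_def)
  have "prod_encode f < prod_encode (nmul k m)"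
    using f(1) by (auto simp: gaps_def S_eq glex_le_iff_prod_encode)
  moreover have "glex_count (Fb S) = prod_encode f"
  proof -
    have "{x. x \<noteq> 0 \<and> to_Z2 x \<preceq>\<^sub>g Fb S} = {x. 0 < prod_encode x \<and> prod_encode x < Suc (prod_encode f)}"
      by (simp add: Fb to_Z2_glex_le glex_le_iff_prod_encode less_Suc_eq_le prod_encode_eq_0_iff
          flip: neq0_conv)
    then show ?thesis
      by (simp add: glex_count_def card_encode_between)
  qed
  ultimately have count: "glex_count (Fb S) + 1 \<le> prod_encode (nmul k m)"
    by simp
  \<comment> \<open>A gap after the last small multiple pushes the Frobenius element beyond all of
    them. For \<open>m = (0, 1)\<close> it is the next point on the diagonal of
    \<open>(0, k - 1)\<close>; \<open>k = 1\<close> would make \<open>S\<close> the full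
    monoid.\<close>
  have "\<exists>h\<in>gaps S. nmul (k - 1) m \<prec>\<^sub>g h"
  proof (cases "m = (0, 1)")
    case True
    have "k \<noteq> 1"
      using assms S_eq by (auto simp: True nmul_def glex_le_def glex_less_def zero_prod_def)
    then have "(1, k - 2) \<in> gaps S" "nmul (k - 1) m \<prec>\<^sub>g (1, k - 2)"
      using gap_unit[OF True, of "k - 2"] k_pos by (auto simp: True nmul_def glex_less_def)
    then show ?thesis
      by blast
  next
    case False
    with k_pos show ?thesis
      by (intro bexI[OF _ gap_above_multiple[of "k - 1"]]) (auto simp: glex_less_def)
  qed
  then have last: "nmul (k - 1) m \<prec>\<^sub>g f"
    using f(2) glex_less_le_trans by blast
  have "(\<lambda>i. nmul i m) ` {..<k} \<subseteq> {s \<in> S. to_Z2 s \<prec>\<^sub>g Fb S}"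
    using glex_le_less_trans[OF nmul_glex_mono last] nmul_mem
    by (auto simp: Fb to_Z2_glex_less)
  moreover have "finite {s \<in> S. to_Z2 s \<prec>\<^sub>g Fb S}"
    by (rule finite_subset[OF _ finite_encode_less[of "prod_encode f"]])
      (auto simp: Fb to_Z2_glex_less glex_less_iff_prod_encode)
  ultimately have "k \<le> wilf_n S"
    unfolding wilf_n_def using card_mono
    by (metis card_image card_lessThan inj_nmul inj_on_subset m_nonzero subset_UNIV)
  then have "k * (prod_encode (nmul (Suc k) m) - prod_encode (nmul k m)) \<le> wilf_n S * embedding_dim S"
    using embedding_dim_ge by (rule mult_le_mono)
  moreover have "prod_encode (nmul k m)
      \<le> k * (prod_encode (nmul (Suc k) m) - prod_encode (nmul k m))"
  proof -
    let ?d = "fst m + snd m"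
    have "2 * prod_encode (nmul k m) = k * (k * (?d * ?d) + ?d + 2 * fst m)"
      by (simp add: double_prod_encode_nmul algebra_simps)
    \<comment> \<open>The two cofactors differ only in the coefficient of \<open>?d * ?d\<close>,
      which is \<open>k\<close> on the left and \<open>2 * k + 1\<close> on the right.\<close>
    also have "\<dots> \<le> k * (2 * (prod_encode (nmul (Suc k) m) - prod_encode (nmul k m)))"
      unfolding double_prod_encode_nmul_diff by (intro mult_le_mono2) simp
    finally show ?thesis
      by simp
  qed
  ultimately show ?thesis
    using count by linarith
qed

end

theorem corollary40:
  fixes S :: "(nat \<times> nat) set"
  assumes "N2_semigroup S" and "mult_embedded S"
  shows "wilf_nu S * embedding_dim S \<ge> 2 * wilf_gamma S \<and>
         (S \<noteq> UNIV \<longrightarrow> wilf_n S * embedding_dim S \<ge> glex_count (Fb S) + 1)"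
proof -
  obtain k m where "mult_embedding S k m"
    using assms by (auto simp: mult_embedded_def mult_embedding_def)
  then show ?thesis
    using mult_embedding.generalized_wilf mult_embedding.extended_wilf by blast
qed

end
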